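(* Let $X\in\mathbb{R}^{m\times n}$ have nonzero columns, let $\{X_1,\dots,X_K\}$ be a segmentation of $X$ (a partition of its columns into nonempty segments), and let $\Pi$ be a permutation matrix with $X\Pi=[X_1,\dots,X_K]$. Let $d=\sum_{k=1}^K r(X_k)$ and let $d_+$ be an integer with $d<d_+\le n$. Then there is a representation matrix $C$ of $X$ of the block-diagonal form $$C=\Pi\,\mathrm{diag}(C_1,\dots,C_K)\,\Pi^T,$$ with $C_k$ square of order $n(X_k)$, such that $r(C)=d_+$ and some of the diagonal blocks $C_k$ are not connected.
   Context: $r(\cdot)$ denotes rank and $n(X_k)$ the number of columns of $X_k$. A representation matrix of $X\in\mathbb{R}^{m\times n}$ is a matrix $C\in\mathbb{R}^{n\times n}$ with $X=XC$. A square matrix $A$ is connected if the undirected graph on its index set with an edge between $i$ and $j$ whenever the $(i,j)$ entry of $|A|+|A|^T$ is nonzero is connected ($|A|$ is the entrywise absolute value). *)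

theory Defs
  imports "Jordan_Normal_Form.DL_Rank" "Graph_Theory.Digraph_Component"
begin

definition permutation_mat :: "nat \<Rightarrow> real mat \<Rightarrow> bool" where
  "permutation_mat n P \<longleftrightarrow>
     (\<exists>p. p permutes {..<n} \<and> P = mat n n (\<lambda>(i, j). if i = p j then 1 else 0))"

definition representation_mat :: "real mat \<Rightarrow> real mat \<Rightarrow> bool" where
  "representation_mat X C \<longleftrightarrow> C \<in> carrier_mat (dim_col X) (dim_col X) \<and> X = X * C"

(* The lists Js partition the column indices, so repeated columns of X are kept apart.
   Each segment may list its columns in any order. *)
definition segmentation :: "real mat \<Rightarrow> real mat list \<Rightarrow> bool" where
  "segmentation X Xs \<longleftrightarrow>
     (\<exists>Js. (\<forall>J \<in> set Js. J \<noteq> []) \<and> distinct (concat Js) \<and> set (concat Js) = {..<dim_col X} \<and>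
           Xs = map (\<lambda>J. mat_of_cols (dim_row X) (map (col X) J)) Js)"

definition hconcat_mat :: "nat \<Rightarrow> real mat list \<Rightarrow> real mat" where
  "hconcat_mat m Xs = mat_of_cols m (concat (map cols Xs))"

(* An undirected edge appears as a pair of opposite arcs; the arc set is symmetric because
   the matrix |A| + |A|^T is. *)
definition mat_graph :: "real mat \<Rightarrow> (nat, nat \<times> nat) pre_digraph" where
  "mat_graph A =
     \<lparr> verts = {..<dim_row A},
       arcs = {(i, j). i < dim_row A \<and> j < dim_row A \<and>
                       (map_mat abs A + transpose_mat (map_mat abs A)) $$ (i, j) \<noteq> 0},
       tail = fst, head = snd \<rparr>"

definition connected_mat :: "real mat \<Rightarrow> bool" where
  "connected_mat A \<longleftrightarrow> Digraph_Component.connected (mat_graph A)"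

end

theory Submission
  imports Defs
begin

text \<open>
  Let \<open>J\<close> index a column basis of a block \<open>A\<close> and let \<open>J \<subseteq> S\<close>. Give the matrix \<open>C\<close> the unit
  vector \<open>e\<^sub>j\<close> as column \<open>j\<close> for \<open>j \<in> S\<close>, and the coefficients of column \<open>j\<close> of \<open>A\<close> in the
  basis \<open>J\<close> otherwise. Then \<open>A C = A\<close>, and \<open>C\<close> is a projection onto the span of the \<open>e\<^sub>j\<close> with
  \<open>j \<in> S\<close>, so it has rank \<open>|S|\<close>. Every index in \<open>S - J\<close> is an isolated vertex of the graph
  of \<open>C\<close>, and there are other vertices because \<open>J\<close> is nonempty when \<open>A\<close> has nonzero columns. The property of being such a coordinate projection passes to block-diagonal matrices
  and to conjugates by permutation matrices, so the ranks of the blocks simply add up, and they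
  can be chosen to have any sum between \<open>d\<close> and \<open>n\<close>.
\<close>

section \<open>Coordinate projections and column bases\<close>

text \<open>The unit columns make \<open>A\<close> fix each \<open>e_j\<close> with
  \<open>j \<in> S\<close>, and the zero rows keep its image inside their span. \<open>S\<close> is
  a parameter because its cardinality is the rank that gets tracked.\<close>

definition coord_proj :: "nat \<Rightarrow> nat set \<Rightarrow> 'a::zero_neq_one mat \<Rightarrow> bool" where
  "coord_proj n S A \<longleftrightarrow> A \<in> carrier_mat n n \<and> S \<subseteq> {..<n} \<and>
     (\<forall>i<n. \<forall>j\<in>S. A $$ (i, j) = (if i = j then 1 else 0)) \<and>
     (\<forall>i<n. \<forall>j<n. i \<notin> S \<longrightarrow> A $$ (i, j) = 0)"

text \<open>A vector of \<open>U\<close> outside \<open>span S\<close> could be adjoined to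
  \<open>S\<close> without losing independence, against maximality. This supplies the coefficients
  in \<open>rank_factorization\<close>.\<close>

lemma (in vec_space) maximal_indpt_spans:
  assumes "U \<subseteq> carrier_vec n" "maximal S (\<lambda>T. T \<subseteq> U \<and> lin_indpt T)"
  shows "U \<subseteq> span S"
proof
  fix x assume x: "x \<in> U"
  have S: "S \<subseteq> U" "lin_indpt S" using assms(2) by (auto simp: maximal_def)
  then have SV: "S \<subseteq> carrier_vec n" using assms(1) by auto
  show "x \<in> span S"
  proof (cases "x \<in> S")
    case True
    then show ?thesis using SV in_own_span[of S] by auto
  next
    case False
    show ?thesis
    proof (rule ccontr)
      assume "x \<notin> span S"
      then have "lin_indpt (S \<union> {x})"
        using lin_dep_iff_in_span[of S x] SV S(2) x assms(1) False by auto
      then have "S \<union> {x} = S"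
        using assms(2) S(1) x unfolding maximal_def by blast
      then show False using False by auto
    qed
  qed
qed

text \<open>The unit vectors indexed by \<open>S\<close> occur among the columns and are
  independent. The zero rows put every column in their span, so they form a maximal independent set
  of columns.\<close>

lemma (in vec_space) rank_coord_proj:
  assumes "coord_proj n S A"
  shows "rank A = card S"
proof -
  have A: "A \<in> carrier_mat n n" and S: "S \<subseteq> {..<n}"
    and unit: "\<And>i j. i < n \<Longrightarrow> j \<in> S \<Longrightarrow> A $$ (i, j) = (if i = j then 1 else 0)"
    and zero: "\<And>i j. i < n \<Longrightarrow> j < n \<Longrightarrow> i \<notin> S \<Longrightarrow> A $$ (i, j) = 0"
    using assms by (auto simp: coord_proj_def)
  have finS: "finite S" using S finite_subset by blast
  let ?T = "unit_vec n ` S :: 'a vec set"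
  have colS: "col A j = unit_vec n j" if "j \<in> S" for j
    using that S A unit by (intro eq_vecI) auto
  have TU: "?T \<subseteq> set (cols A)"
    using S A colS by (force simp: cols_def)
  have UV: "set (cols A) \<subseteq> carrier_vec n" using cols_dim A by blast
  have TV: "?T \<subseteq> carrier_vec n" by auto
  have inj: "inj_on (unit_vec n :: nat \<Rightarrow> 'a vec) S"
    using S by (intro inj_onI) (metis index_unit_vec(1) lessThan_iff subsetD zero_neq_one)
  have "?T \<subseteq> set (unit_vecs n)" using S by (auto simp: unit_vecs_def)
  then have li: "lin_indpt ?T"
    using unit_vecs_basis subset_li_is_li unfolding basis_def by blast
  have span: "set (cols A) \<subseteq> span ?T"
  proof
    fix x assume x: "x \<in> set (cols A)"
    then obtain j where j: "j < n" "x = col A j" using A by (auto simp: cols_def)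
    \<comment> \<open>The coefficient of \<open>unit_vec n i\<close> is entry \<open>i\<close> of
      \<open>x\<close>; injectivity of \<open>unit_vec n\<close> on \<open>S\<close> makes the index
      unique.\<close>
    define a where "a v = x $ (THE i. i \<in> S \<and> v = unit_vec n i)" for v :: "'a vec"
    have a: "a (unit_vec n i) = x $ i" if "i \<in> S" for i
      unfolding a_def using that inj
      by (intro arg_cong[of _ _ "($) x"] the_equality) (auto dest: inj_onD)
    have "x = lincomb a ?T"
    proof (rule eq_vecI)
      show "dim_vec x = dim_vec (lincomb a ?T)"
        using lincomb_dim[OF finite_imageI[OF finS] TV] j A by auto
      fix i assume "i < dim_vec (lincomb a ?T)"
      then have i: "i < n" using lincomb_dim[OF finite_imageI[OF finS] TV] by auto
      have "lincomb a ?T $ i = (\<Sum>v\<in>?T. a v * v $ i)"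
        by (rule lincomb_index[OF i TV])
      also have "\<dots> = (\<Sum>l\<in>S. a (unit_vec n l) * unit_vec n l $ i)"
        using inj by (simp add: sum.reindex)
      also have "\<dots> = (\<Sum>l\<in>S. if l = i then x $ i else 0)"
        using i S a by (intro sum.cong) auto
      \<comment> \<open>For \<open>i \<notin> S\<close> the sum is 0, and so is
        \<open>x $ i\<close>, because row \<open>i\<close> of \<open>A\<close> vanishes.\<close>
      also have "\<dots> = x $ i"
        using finS i j zero[OF i j(1)] A by auto
      finally show "x $ i = lincomb a ?T $ i" ..
    qed
    then show "x \<in> span ?T" using finS TV by (auto simp: span_def)
  qed
  have "maximal ?T (\<lambda>T. T \<subseteq> set (cols A) \<and> lin_indpt T)"
    unfolding maximal_def
  proof (intro conjI allI impI)
    fix T' assume T': "?T \<subseteq> T' \<and> T' \<subseteq> set (cols A) \<and> lin_indpt T'"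
    show "T' = ?T"
    proof (rule ccontr)
      assume "T' \<noteq> ?T"
      then obtain x where x: "x \<in> T'" "x \<notin> ?T" using T' by blast
      have "lin_indpt (?T \<union> {x})"
        using T' x by (metis Un_least empty_subsetI insert_subset subset_li_is_li)
      moreover have "x \<in> span ?T" "x \<in> carrier_vec n" using x T' span UV by auto
      ultimately show False using lin_dep_iff_in_span[of ?T x] TV li x by auto
    qed
  qed (use TU li in auto)
  then have "rank A = card ?T" by (rule rank_card_indpt[OF A])
  then show ?thesis using inj by (simp add: card_image)
qed

text \<open>The columns are combinations of a maximal independent set of columns. That set is
  recorded by indices, since the construction of \<open>C\<close> needs positions rather than
  vectors.\<close>

lemma (in vec_space) rank_factorization:
  assumes A: "A \<in> carrier_mat n nc"
  obtains J F where "J \<subseteq> {..<nc}" "card J = rank A"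
    "\<And>i j. i < n \<Longrightarrow> j < nc \<Longrightarrow> A $$ (i, j) = (\<Sum>l\<in>J. A $$ (i, l) * F l j)"
proof -
  obtain S where S: "finite S" "maximal S (\<lambda>T. T \<subseteq> set (cols A) \<and> lin_indpt T)"
    using maximal_exists_superset[of "set (cols A)" "\<lambda>T. T \<subseteq> set (cols A) \<and> lin_indpt T" "{}"]
      lin_dep_def by auto
  have UV: "set (cols A) \<subseteq> carrier_vec n" using cols_dim A by blast
  have SU: "S \<subseteq> set (cols A)" using S by (auto simp: maximal_def)
  have "\<forall>v\<in>S. \<exists>j. j < nc \<and> col A j = v" using SU A by (force simp: cols_def)
  \<comment> \<open>\<open>f\<close> picks one index for each basis vector, so that repeated columns
    are counted once; \<open>col A\<close> inverts it, hence it is injective.\<close>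
  then obtain f where f: "\<And>v. v \<in> S \<Longrightarrow> f v < nc \<and> col A (f v) = v" by metis
  have inj: "inj_on f S" by (rule inj_onI) (metis f)
  have "\<exists>a. col A j = lincomb a S" if "j < nc" for j
  proof -
    have "col A j \<in> span S"
      using maximal_indpt_spans[OF UV S(2)] that A by (auto simp: cols_def)
    then show ?thesis using finite_span[OF S(1)] SU UV by auto
  qed
  then obtain a where a: "\<And>j. j < nc \<Longrightarrow> col A j = lincomb (a j) S" by metis
  show ?thesis
  proof (rule that[of "f ` S" "\<lambda>l j. a j (col A l)"])
    show "f ` S \<subseteq> {..<nc}" using f by auto
    show "card (f ` S) = rank A" using inj rank_card_indpt[OF A S(2)] by (simp add: card_image)
    fix i j assume ij: "i < n" "j < nc"
    have "A $$ (i, j) = lincomb (a j) S $ i" using a[OF ij(2)] ij A by (metis carrier_matD index_col)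
    also have "\<dots> = (\<Sum>v\<in>S. a j v * v $ i)"
      using SU UV by (intro lincomb_index[OF ij(1)]) auto
    also have "\<dots> = (\<Sum>v\<in>S. A $$ (i, f v) * a j (col A (f v)))"
      using f ij A by (intro sum.cong) (auto simp: mult.commute, metis carrier_matD index_col)
    also have "\<dots> = (\<Sum>l\<in>f ` S. A $$ (i, l) * a j (col A l))"
      using inj by (simp add: sum.reindex)
    finally show "A $$ (i, j) = (\<Sum>l\<in>f ` S. A $$ (i, l) * a j (col A l))" .
  qed
qed

section \<open>Blocks of prescribed rank\<close>

text \<open>A walk that starts at \<open>t\<close> never leaves \<open>t\<close>, so it misses
  \<open>u\<close>. The diagonal entry at \<open>t\<close> is unrestricted, as it only produces a
  loop.\<close>

lemma isolated_not_connected_mat: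
  assumes A: "A \<in> carrier_mat n n" and "t < n" "u < n" "t \<noteq> u"
    and isolated: "\<And>j. j < n \<Longrightarrow> j \<noteq> t \<Longrightarrow> A $$ (t, j) = 0 \<and> A $$ (j, t) = 0"
  shows "\<not> connected_mat A"
proof
  let ?G = "mat_graph A"
  assume "connected_mat A"
  then have "(t, u) \<in> rtrancl_on (verts ?G) ((arcs_ends ?G)\<^sup>s)"
    using assms by (auto simp: connected_mat_def connected_conv mat_graph_def)
  moreover have "y = t" if "(t, y) \<in> rtrancl_on (verts ?G) ((arcs_ends ?G)\<^sup>s)" for y
    using that
  proof (induction rule: rtrancl_on_induct)
    case (step b c)
    then show ?case
      using A isolated[of c] by (cases "c = t") (auto simp: symcl_def arcs_ends_conv mat_graph_def)
  qed simp
  ultimately show False using \<open>t \<noteq> u\<close> by auto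
qed

text \<open>Any rank from that of \<open>A\<close> up to the number of columns is attainable. A
  strict surplus over the rank of \<open>A\<close> forces an index in \<open>S - J\<close>, which
  disconnects the graph.\<close>

lemma representation_block_exists:
  fixes A :: "real mat"
  assumes A: "A \<in> carrier_mat m n" and nz: "\<And>j. j < n \<Longrightarrow> col A j \<noteq> 0\<^sub>v m"
    and s: "vec_space.rank m A \<le> s" "s \<le> n"
  obtains C S where "coord_proj n S C" "card S = s" "A * C = A"
    "vec_space.rank m A < s \<Longrightarrow> \<not> connected_mat C"
proof -
  obtain J F where J: "J \<subseteq> {..<n}" "card J = vec_space.rank m A"
    and F: "\<And>i j. i < m \<Longrightarrow> j < n \<Longrightarrow> A $$ (i, j) = (\<Sum>l\<in>J. A $$ (i, l) * F l j)"
    using vec_space.rank_factorization[OF A] by blast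
  have finJ: "finite J" using J finite_subset by blast
  obtain S where S: "J \<subseteq> S" "S \<subseteq> {..<n}" "card S = s"
    using exists_subset_between[of J s "{..<n}"] J s finJ by auto
  define C where "C = mat n n (\<lambda>(i, j). if j \<in> S then (if i = j then 1 else 0)
      else if i \<in> J then F i j else 0)"
  have C: "C \<in> carrier_mat n n" by (simp add: C_def)
  show ?thesis
  proof (rule that[of S C])
    show "coord_proj n S C" using S by (auto simp: coord_proj_def C_def)
    show "card S = s" by (rule S)
    show "A * C = A"
    proof (rule eq_matI)
      fix i j assume "i < dim_row A" "j < dim_col A"
      then have ij: "i < m" "j < n" using A by auto
      have "(A * C) $$ (i, j) = (\<Sum>l<n. A $$ (i, l) * C $$ (l, j))"
        using ij A C by (auto simp: scalar_prod_def lessThan_atLeast0)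
      also have "\<dots> = A $$ (i, j)"
      proof (cases "j \<in> S")
        case True
        then have "(\<Sum>l<n. A $$ (i, l) * C $$ (l, j)) = (\<Sum>l<n. if l = j then A $$ (i, l) else 0)"
          using ij by (intro sum.cong) (auto simp: C_def)
        then show ?thesis using ij by simp
      next
        case False
        \<comment> \<open>Column \<open>j\<close> of \<open>C\<close> is supported on
          \<open>J\<close>, so the sum shrinks to the factorization of column \<open>j\<close> of
          \<open>A\<close>.\<close>
        then have "(\<Sum>l<n. A $$ (i, l) * C $$ (l, j)) = (\<Sum>l\<in>J. A $$ (i, l) * F l j)"
          using ij J by (intro sum.mono_neutral_cong_right) (auto simp: C_def)
        then show ?thesis using F[OF ij] by simp
      qed
      finally show "(A * C) $$ (i, j) = A $$ (i, j)" .
    qed (use A C in auto)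
    assume less: "vec_space.rank m A < s"
    then obtain t where t: "t \<in> S" "t \<notin> J"
      using less J S by (metis less_irrefl subsetI subset_antisym)
    \<comment> \<open>With \<open>J\<close> empty, the factorization would make every column of
      \<open>A\<close> zero.\<close>
    have "J \<noteq> {}"
    proof
      assume "J = {}"
      then have "col A t = 0\<^sub>v m" using F A t S by (intro eq_vecI) auto
      then show False using nz t S by auto
    qed
    then obtain u where u: "u \<in> J" by blast
    \<comment> \<open>Column \<open>t\<close> is a unit vector because \<open>t \<in> S\<close>; row
      \<open>t\<close> vanishes off the diagonal because \<open>t \<notin> J\<close>. The second
      vertex \<open>u\<close> lies in \<open>J\<close>, so it differs from \<open>t\<close>.\<close>
    show "\<not> connected_mat C"
      by (rule isolated_not_connected_mat[OF C, of t u]) (use t u J S in \<open>auto simp: C_def\<close>)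
  qed
qed

section \<open>Block-diagonal matrices and concatenation\<close>

text \<open>The index set of the whole is the disjoint union of the index sets of the blocks, each
  shifted by the sizes of the preceding blocks. Additivity of rank thus becomes additivity of
  cardinality.\<close>

lemma coord_proj_diag_block_mat:
  assumes "list_all2 (\<lambda>C s. \<exists>S. coord_proj (dim_row C) S C \<and> card S = s) Cs ss"
  shows "\<exists>S. coord_proj (dim_row (diag_block_mat Cs)) S (diag_block_mat Cs) \<and> card S = sum_list ss"
  using assms
proof induction
  case Nil
  then show ?case by (auto simp: coord_proj_def)
next
  case (Cons C Cs s ss)
  define a where "a = dim_row C"
  define b where "b = dim_row (diag_block_mat Cs)"
  let ?B = "diag_block_mat Cs"
  from Cons obtain S where S: "coord_proj a S C" "card S = s" by (auto simp: a_def)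
  from Cons obtain T where T: "coord_proj b T ?B" "card T = sum_list ss" by (auto simp: b_def)
  have C: "C \<in> carrier_mat a a" and B: "?B \<in> carrier_mat b b"
    using S T by (auto simp: coord_proj_def)
  have sub: "S \<subseteq> {..<a}" "T \<subseteq> {..<b}" using S T by (auto simp: coord_proj_def)
  have D: "diag_block_mat (C # Cs) = four_block_mat C (0\<^sub>m a b) (0\<^sub>m b a) ?B"
    using C B by (auto simp: Let_def)
  let ?U = "S \<union> (+) a ` T"
  \<comment> \<open>This splits membership by the same test \<open>i < a\<close> that selects a
    block of \<open>four_block_mat\<close>.\<close>
  have mem: "i \<in> ?U \<longleftrightarrow> (if i < a then i \<in> S else i - a \<in> T)" for i
  proof (cases "i < a")
    case False
    then show ?thesis using sub by (force simp: image_iff)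
  qed auto
  have "coord_proj (a + b) ?U (diag_block_mat (C # Cs))"
    unfolding coord_proj_def D
  proof (intro conjI allI impI ballI)
    show "?U \<subseteq> {..<a + b}" using sub by auto
    fix i assume i: "i < a + b"
    {
      fix j assume "j \<in> ?U"
      then have "j < a + b" using sub by auto
      moreover have "if j < a then j \<in> S else j - a \<in> T" using \<open>j \<in> ?U\<close> mem by blast
      ultimately show "four_block_mat C (0\<^sub>m a b) (0\<^sub>m b a) ?B $$ (i, j) = (if i = j then 1 else 0)"
        using i S(1) T(1) C B by (auto simp: coord_proj_def split: if_splits)
    next
      fix j assume "j < a + b" "i \<notin> ?U"
      moreover have "if i < a then i \<notin> S else i - a \<notin> T" using \<open>i \<notin> ?U\<close> mem[of i] by presburger
      ultimately show "four_block_mat C (0\<^sub>m a b) (0\<^sub>m b a) ?B $$ (i, j) = 0"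
        using i S(1) T(1) C B by (auto simp: coord_proj_def split: if_splits)
    }
  qed (use C B in auto)
  moreover have "card ?U = s + sum_list ss"
    using S(2) T(2) sub finite_subset[OF sub(1)] finite_subset[OF sub(2)]
    by (subst card_Un_disjoint) (auto simp: card_image)
  moreover have "dim_row (diag_block_mat (C # Cs)) = a + b"
    unfolding D using C B by auto
  ultimately show ?case by auto
qed

lemma hconcat_mat_carrier: "hconcat_mat m Xs \<in> carrier_mat m (\<Sum>A\<leftarrow>Xs. dim_col A)"
  by (auto simp: hconcat_mat_def length_concat o_def intro!: carrier_matI)

text \<open>The lower blocks have no rows; this form lets the multiplication rule for four-block
  matrices apply to a concatenation.\<close>

lemma hconcat_mat_Cons:
  assumes "A \<in> carrier_mat m n" and H: "hconcat_mat m Xs \<in> carrier_mat m k"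
  shows "hconcat_mat m (A # Xs) = four_block_mat A (hconcat_mat m Xs) (0\<^sub>m 0 n) (0\<^sub>m 0 k)"
proof (rule eq_matI)
  fix i j assume "i < dim_row (four_block_mat A (hconcat_mat m Xs) (0\<^sub>m 0 n) (0\<^sub>m 0 k))"
    "j < dim_col (four_block_mat A (hconcat_mat m Xs) (0\<^sub>m 0 n) (0\<^sub>m 0 k))"
  then show "hconcat_mat m (A # Xs) $$ (i, j) =
      four_block_mat A (hconcat_mat m Xs) (0\<^sub>m 0 n) (0\<^sub>m 0 k) $$ (i, j)"
    using assms by (auto simp: hconcat_mat_def mat_of_cols_def nth_append)
qed (use assms in \<open>auto simp: hconcat_mat_def\<close>)

text \<open>In the block product the off-diagonal zeros leave \<open>A * C\<close> and the product
  for the tail. The dimensions are carried through the induction because the block product needs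
  them.\<close>

lemma hconcat_mat_mult_diag_block_mat:
  assumes "list_all2 (\<lambda>A C. dim_row A = m \<and> C \<in> carrier_mat (dim_col A) (dim_col A) \<and> A * C = A) Xs Cs"
  shows "hconcat_mat m Xs * diag_block_mat Cs = hconcat_mat m Xs \<and>
    diag_block_mat Cs \<in> carrier_mat (\<Sum>A\<leftarrow>Xs. dim_col A) (\<Sum>A\<leftarrow>Xs. dim_col A)"
  using assms
proof induction
  case Nil
  show ?case by (auto simp: hconcat_mat_def intro!: eq_matI)
next
  case (Cons A Xs C Cs)
  define a where "a = dim_col A"
  define b where "b = (\<Sum>A\<leftarrow>Xs. dim_col A)"
  let ?B = "diag_block_mat Cs" and ?H = "hconcat_mat m Xs"
  have A: "A \<in> carrier_mat m a" and C: "C \<in> carrier_mat a a" and AC: "A * C = A"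
    using Cons(1) by (auto simp: a_def)
  have B: "?B \<in> carrier_mat b b" and H: "?H \<in> carrier_mat m b" and HB: "?H * ?B = ?H"
    using Cons.IH hconcat_mat_carrier[of m Xs] by (auto simp: b_def)
  have D: "diag_block_mat (C # Cs) = four_block_mat C (0\<^sub>m a b) (0\<^sub>m b a) ?B"
    using C B by (auto simp: Let_def)
  have "hconcat_mat m (A # Xs) * diag_block_mat (C # Cs) = hconcat_mat m (A # Xs)"
    unfolding D hconcat_mat_Cons[OF A H]
    by (subst mult_four_block_mat[OF A H _ _ C _ _ B])
      (use A C B H in \<open>auto simp: AC HB intro!: cong_four_block_mat\<close>)
  then show ?case using D C B by (auto simp: a_def b_def)
qed

section \<open>Permutation matrices\<close>

lemma permutation_mat_orthogonal:
  assumes "permutation_mat n P"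
  shows "P \<in> carrier_mat n n" "P * transpose_mat P = 1\<^sub>m n"
proof -
  obtain p where p: "p permutes {..<n}" and P: "P = mat n n (\<lambda>(i, j). if i = p j then 1 else 0)"
    using assms by (auto simp: permutation_mat_def)
  show carr: "P \<in> carrier_mat n n" by (simp add: P)
  show "P * transpose_mat P = 1\<^sub>m n"
  proof (rule eq_matI)
    fix i j assume "i < dim_row (1\<^sub>m n :: real mat)" "j < dim_col (1\<^sub>m n :: real mat)"
    then have ij: "i < n" "j < n" by auto
    have "(P * transpose_mat P) $$ (i, j) = (\<Sum>l<n. P $$ (i, l) * P $$ (j, l))"
      using ij carr by (auto simp: scalar_prod_def lessThan_atLeast0)
    \<comment> \<open>Column \<open>l\<close> of \<open>P\<close> has its 1 in row
      \<open>p l\<close>, so the summand depends on \<open>l\<close> only through \<open>p l\<close>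
      and the sum can be reindexed along \<open>p\<close>.\<close>
    also have "\<dots> = (\<Sum>l<n. (\<lambda>q. if i = q \<and> j = q then 1 else 0) (p l))"
      using ij by (intro sum.cong) (auto simp: P)
    also have "\<dots> = (\<Sum>q<n. if i = q \<and> j = q then 1 else 0)"
      using sum.permute[OF p, of "\<lambda>q. if i = q \<and> j = q then 1 else (0::real)"] by (simp add: o_def)
    also have "\<dots> = (if i = j then 1 else 0)" using ij by (cases "i = j") auto
    finally show "(P * transpose_mat P) $$ (i, j) = 1\<^sub>m n $$ (i, j)" using ij by simp
  qed (use carr in auto)
qed

lemma coord_proj_permute:
  assumes "permutation_mat n P" and D: "coord_proj n S D"
  obtains T where "coord_proj n T (P * D * transpose_mat P)" "card T = card S"
proof -
  obtain p where p: "p permutes {..<n}" and P: "P = mat n n (\<lambda>(i, j). if i = p j then 1 else 0)"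
    using assms by (auto simp: permutation_mat_def)
  let ?C = "P * D * transpose_mat P"
  have carr: "P \<in> carrier_mat n n" "D \<in> carrier_mat n n" and S: "S \<subseteq> {..<n}"
    using D by (auto simp: P coord_proj_def)
  have bij: "bij_betw p {..<n} {..<n}" using p by (rule permutes_imp_bij)
  have lt: "p i < n \<longleftrightarrow> i < n" for i using permutes_in_image[OF p, of i] by simp
  have eq: "p i = p j \<longleftrightarrow> i = j" for i j using permutes_inj[OF p] by (auto dest: injD)
  have PD: "(P * D) $$ (p i, j) = D $$ (i, j)" if "i < n" "j < n" for i j
  proof -
    have "(P * D) $$ (p i, j) = (\<Sum>l<n. P $$ (p i, l) * D $$ (l, j))"
      using that carr lt by (auto simp: scalar_prod_def lessThan_atLeast0)
    also have "\<dots> = (\<Sum>l<n. if l = i then D $$ (l, j) else 0)"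
      using that lt by (intro sum.cong) (auto simp: P eq)
    finally show ?thesis using that by simp
  qed
  have ent: "?C $$ (p i, p j) = D $$ (i, j)" if "i < n" "j < n" for i j
  proof -
    define M where "M = P * D"
    have M: "M \<in> carrier_mat n n" using carr by (simp add: M_def)
    have ent_M: "M $$ (p i, l) = D $$ (i, l)" if "l < n" for l
      using PD[OF \<open>i < n\<close> that] by (simp add: M_def)
    have "?C $$ (p i, p j) = (\<Sum>l<n. M $$ (p i, l) * P $$ (p j, l))"
      unfolding M_def[symmetric]
      using that carr(1) M lt by (auto simp: scalar_prod_def lessThan_atLeast0)
    also have "\<dots> = (\<Sum>l<n. if l = j then D $$ (i, l) else 0)"
      using that lt by (intro sum.cong) (auto simp: P eq ent_M)
    finally show ?thesis using that by simp
  qed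
  have surj: "\<exists>i'<n. i = p i'" if "i < n" for i
    using that bij by (auto simp: bij_betw_def image_iff set_eq_iff)
  show ?thesis
  proof (rule that[of "p ` S"])
    show "card (p ` S) = card S"
      using permutes_inj[OF p] by (simp add: card_image inj_on_subset)
    show "coord_proj n (p ` S) ?C"
      unfolding coord_proj_def
    proof (intro conjI allI impI ballI)
      show "p ` S \<subseteq> {..<n}" using S lt by auto
      fix i assume "i < n"
      then obtain i' where i: "i' < n" "i = p i'" using surj by blast
      {
        fix j assume "j \<in> p ` S"
        then show "?C $$ (i, j) = (if i = j then 1 else 0)"
          using i S D by (auto simp: ent eq coord_proj_def subset_iff)
      next
        fix j assume "j < n" "i \<notin> p ` S"
        then obtain j' where "j' < n" "j = p j'" "i' \<notin> S" using surj i by blast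
        then show "?C $$ (i, j) = 0"
          using i D by (auto simp: ent coord_proj_def)
      }
    qed (use carr in auto)
  qed
qed

section \<open>Distribution of the rank and assembly\<close>

text \<open>Greedy choice: the head takes as much as its upper bound permits while leaving the tail
  the sum of its lower bounds.\<close>

lemma sum_list_intermediate:
  fixes rs ns :: "nat list"
  assumes "list_all2 (\<le>) rs ns" "sum_list rs \<le> t" "t \<le> sum_list ns"
  shows "\<exists>ss. list_all2 (\<le>) rs ss \<and> list_all2 (\<le>) ss ns \<and> sum_list ss = t"
  using assms
proof (induction arbitrary: t)
  case (Cons r rs k ns)
  have le: "sum_list rs \<le> sum_list ns"
    using Cons.hyps(2) by induction auto
  define s where "s = min k (t - sum_list rs)"
  \<comment> \<open>If the minimum is \<open>k\<close>, the upper bound comes from that on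
    \<open>t\<close>; otherwise exactly \<open>sum_list rs\<close> remains, and \<open>le\<close>
    applies. The natural subtractions do not truncate.\<close>
  have "sum_list rs \<le> t - s" "t - s \<le> sum_list ns"
    using Cons.prems le by (auto simp: s_def)
  then obtain ss where "list_all2 (\<le>) rs ss" "list_all2 (\<le>) ss ns" "sum_list ss = t - s"
    using Cons.IH by blast
  then show ?case
    using Cons.hyps Cons.prems by (intro exI[of _ "s # ss"]) (auto simp: s_def)
qed simp

theorem theorem9:
  fixes X P :: "real mat" and Xs :: "real mat list" and m n d d_plus :: nat
  assumes "X \<in> carrier_mat m n"
    and "\<forall>j<n. col X j \<noteq> 0\<^sub>v m"
    and "segmentation X Xs"
    and "permutation_mat n P"
    and "X * P = hconcat_mat m Xs"
    and "d = (\<Sum>k<length Xs. vec_space.rank m (Xs ! k))"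
    and "d < d_plus" and "d_plus \<le> n"
  shows "\<exists>C Cs. length Cs = length Xs \<and>
           (\<forall>k<length Xs. Cs ! k \<in> carrier_mat (dim_col (Xs ! k)) (dim_col (Xs ! k))) \<and>
           C = P * diag_block_mat Cs * transpose_mat P \<and>
           representation_mat X C \<and>
           vec_space.rank n C = d_plus \<and>
           (\<exists>k<length Xs. \<not> connected_mat (Cs ! k))"
proof -
  let ?K = "length Xs" and ?r = "vec_space.rank m :: real mat \<Rightarrow> nat"
  note P = permutation_mat_orthogonal[OF assms(4)]
  obtain Js where Js: "set (concat Js) = {..<n}"
    and Xs: "Xs = map (\<lambda>J. mat_of_cols m (map (col X) J)) Js"
    using assms(1,3) by (auto simp: segmentation_def)
  have block: "A \<in> carrier_mat m (dim_col A)" "\<And>j. j < dim_col A \<Longrightarrow> col A j \<noteq> 0\<^sub>v m"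
    if A: "A \<in> set Xs" for A
  proof -
    obtain J where J: "J \<in> set Js" "A = mat_of_cols m (map (col X) J)"
      using A Xs by auto
    then show "A \<in> carrier_mat m (dim_col A)" by auto
    fix j assume j: "j < dim_col A"
    then have "J ! j < n" using J Js nth_mem[of j J] by fastforce
    then show "col A j \<noteq> 0\<^sub>v m" using J j assms(1,2) by auto
  qed
  have "dim_col (X * P) = n" using P by simp
  then have n: "(\<Sum>A\<leftarrow>Xs. dim_col A) = n"
    using hconcat_mat_carrier[of m Xs] assms(5) by auto
  have d: "d = (\<Sum>A\<leftarrow>Xs. ?r A)"
    using assms(6) by (simp add: sum_list_sum_nth lessThan_atLeast0)
  have "list_all2 (\<le>) (map ?r Xs) (map dim_col Xs)"
    using vec_space.rank_le_nc[OF block(1)] by (auto simp: list_all2_conv_all_nth)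
  \<comment> \<open>\<open>ss\<close> prescribes the ranks of the diagonal blocks, with total
    \<open>d_plus\<close>.\<close>
  then obtain ss where "list_all2 (\<le>) (map ?r Xs) ss" "list_all2 (\<le>) ss (map dim_col Xs)"
    and sum: "sum_list ss = d_plus"
    using sum_list_intermediate[of "map ?r Xs" "map dim_col Xs" d_plus] assms(7,8) d n by auto
  then have len: "length ss = ?K"
    and bounds: "\<And>k. k < ?K \<Longrightarrow> ?r (Xs ! k) \<le> ss ! k" "\<And>k. k < ?K \<Longrightarrow> ss ! k \<le> dim_col (Xs ! k)"
    by (auto simp: list_all2_conv_all_nth)
  have "\<forall>k<?K. \<exists>C. (\<exists>S. coord_proj (dim_col (Xs ! k)) S C \<and> card S = ss ! k) \<and> Xs ! k * C = Xs ! k \<and>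
      (?r (Xs ! k) < ss ! k \<longrightarrow> \<not> connected_mat C)"
  proof (intro allI impI)
    fix k assume k: "k < ?K"
    then have "Xs ! k \<in> set Xs" by simp
    from representation_block_exists[OF block[OF this] bounds[OF k]]
    show "\<exists>C. (\<exists>S. coord_proj (dim_col (Xs ! k)) S C \<and> card S = ss ! k) \<and> Xs ! k * C = Xs ! k \<and>
        (?r (Xs ! k) < ss ! k \<longrightarrow> \<not> connected_mat C)" by metis
  qed
  then obtain Cf where Cf: "\<And>k. k < ?K \<Longrightarrow> \<exists>S. coord_proj (dim_col (Xs ! k)) S (Cf k) \<and> card S = ss ! k"
      "\<And>k. k < ?K \<Longrightarrow> Xs ! k * Cf k = Xs ! k"
      "\<And>k. k < ?K \<Longrightarrow> ?r (Xs ! k) < ss ! k \<Longrightarrow> \<not> connected_mat (Cf k)"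
    by metis
  define Cs where "Cs = map Cf [0..<?K]"
  have Ck: "Cf k \<in> carrier_mat (dim_col (Xs ! k)) (dim_col (Xs ! k))" if "k < ?K" for k
    using Cf(1)[OF that] by (auto simp: coord_proj_def)
  define D where "D = diag_block_mat Cs"
  define C where "C = P * D * transpose_mat P"
  have "list_all2 (\<lambda>C s. \<exists>S. coord_proj (dim_row C) S C \<and> card S = s) Cs ss"
    using Cf(1) carrier_matD(1)[OF Ck] len by (auto simp: list_all2_conv_all_nth Cs_def)
  then obtain S where S: "coord_proj (dim_row D) S D" "card S = d_plus"
    using coord_proj_diag_block_mat sum unfolding D_def by blast
  have HD: "hconcat_mat m Xs * D = hconcat_mat m Xs" and D: "D \<in> carrier_mat n n"
    using hconcat_mat_mult_diag_block_mat[of m Xs Cs] Cf(2) Ck carrier_matD(1)[OF block(1)] n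
    by (auto simp: list_all2_conv_all_nth Cs_def D_def)
  obtain T where T: "coord_proj n T C" "card T = d_plus"
    using coord_proj_permute[OF assms(4)] S D unfolding C_def by (metis carrier_matD(1))
  have rank: "vec_space.rank n C = d_plus"
    using vec_space.rank_coord_proj[OF T(1)] T(2) by simp
  \<comment> \<open>Orthogonality turns the invariance of \<open>X * P\<close> under
    \<open>D\<close> into that of \<open>X\<close> under \<open>C\<close>.\<close>
  have X: "X = X * P * transpose_mat P"
    using P assms(1) by (simp add: assoc_mult_mat[of _ m n _ n _ n])
  have "X * C = X * P * D * transpose_mat P"
    unfolding C_def using P D assms(1) by (simp add: assoc_mult_mat[of _ _ n _ n _ n])
  also have "\<dots> = X" using HD X assms(5) by simp
  finally have rep: "representation_mat X C"
    using assms(1) P D by (auto simp: representation_mat_def C_def)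
  \<comment> \<open>The prescribed ranks sum to more than \<open>d\<close>, so some block gets more
    than the rank of its segment; that block is not connected.\<close>
  have "\<exists>k<?K. ?r (Xs ! k) < ss ! k"
  proof (rule ccontr)
    assume "\<not> ?thesis"
    then have "sum_list ss \<le> d"
      using len unfolding assms(6) by (auto simp: sum_list_sum_nth lessThan_atLeast0 intro!: sum_mono)
    then show False using sum assms(7) by simp
  qed
  then have "\<exists>k<?K. \<not> connected_mat (Cs ! k)" using Cf(3) by (auto simp: Cs_def)
  then show ?thesis
    using rank rep Ck by (intro exI[of _ C] exI[of _ Cs]) (auto simp: Cs_def C_def D_def)
qed

end
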